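(* Let $\mathcal{S}=(V,\Sigma,\delta)$ be a nondeterministic fuzzy transition system, $k\in\mathbb{N}$, $\alpha\in[0,1]$ and $u,v\in V$. Then $u\approx_k^\alpha v$ if and only if $u\sim^\alpha v$ in $T_{\mathcal{S}}(u,k)$ and $T_{\mathcal{S}}(v,k)$, i.e. the pair of roots $(u_0,v_0)$ belongs to some $\alpha$-bisimulation under $\widetilde{S}$ between the $k$-neighbouring path induced subsystems $T_{\mathcal{S}}(u,k)$ and $T_{\mathcal{S}}(v,k)$.
   Context: Let $\otimes$ be a fixed left-continuous $t$-norm on $[0,1]$: commutative, associative, increasing, with neutral element $1$, and $r\otimes\bigvee_i r_i=\bigvee_i (r\otimes r_i)$. Its residuum is $t\rightarrow r=\bigvee\{s\in[0,1]: s\otimes t\le r\}$. $\wedge,\vee$ (and $\bigwedge,\bigvee$) are min, max (inf, sup) in $[0,1]$; $\mathbb{N}$ contains $0$. $V$ is a nonempty finite set; $\mathcal{R}(V)$ is the set of fuzzy subsets of $V$ (maps $V\to[0,1]$), also called distributions. For $p\in\mathcal{R}(V)$ and $X\subseteq V$, $p(X)=\bigvee_{x\in X}p(x)$ (with $p(\emptyset)=0$). A nondeterministic fuzzy transition system (NFTS) is a triple $\mathcal{S}=(V,\Sigma,\delta)$ with $\Sigma$ a set of labels and $\delta\subseteq V\times\Sigma\times\mathcal{R}(V)$; $\delta(u,\tau)=\{p:(u,\tau,p)\in\delta\}$, and $u\overset{\tau}{\longrightarrow}p$ means $p\in\delta(u,\tau)$. For $R\subseteq V_1\times V_2$, $p\in\mathcal{R}(V_1)$,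 $q\in\mathcal{R}(V_2)$: $\overrightarrow{R}_x=\{y:(x,y)\in R\}$, $\overleftarrow{R}_y=\{x:(x,y)\in R\}$, $\widetilde{S}(p,q,R)=\bigwedge_{x\in V_1}(p(x)\rightarrow q(\overrightarrow{R}_x))\wedge\bigwedge_{y\in V_2}(q(y)\rightarrow p(\overleftarrow{R}_y))$, and $R_\alpha^\dagger=\{(p,q):\widetilde{S}(p,q,R)\ge\alpha\}$. $k$-limited $\alpha$-bisimilarity $\approx_k^{\alpha}\subseteq V\times V$: $u\approx_0^\alpha v$ for all $u,v$; and $u\approx_{i+1}^\alpha v$ iff for each $\tau\in\Sigma$: $u\overset{\tau}{\longrightarrow}p$ implies there is $v\overset{\tau}{\longrightarrow}q$ with $(p,q)\in(\approx_i^\alpha)_\alpha^\dagger$; and $v\overset{\tau}{\longrightarrow}q$ implies there is $u\overset{\tau}{\longrightarrow}p$ with $(p,q)\in(\approx_i^\alpha)_\alpha^\dagger$. An $\alpha$-bisimulation under $\widetilde{S}$ between NFTSs with state sets $V_1,V_2$ is a relation $R\subseteq V_1\times V_2$ such that for all $(x,y)\in R$ and every label $\tau$: $x\overset{\tau}{\longrightarrow}p$ implies there is $y\overset{\tau}{\longrightarrow}q$ with $(p,q)\in R_\alpha^\dagger$; and $y\overset{\tau}{\longrightarrow}q$ implies there is $x\overset{\tau}{\longrightarrow}p$ with $(p,q)\in R_\alpha^\dagger$. $D_u[0]=\{u\}$ and $D_u[i+1]=\{y\in V:\exists x\in D_u[i],\tau\in\Sigma,p\in\delta(x,\tau)\text{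 with }p(y)>0\}$. The $k$-neighbouring path induced subsystem $T_{\mathcal{S}}(u,k)=(V',\Sigma',\delta')$ is the NFTS with $V'=\{x_i: 0\le i\le k,\ x\in D_u[i]\}$, where $x_i=(x,i)$ is a copy of $x$ at level $i$; for $i<k$, $\delta'(x_i,\tau)=\{p':p\in\delta(x,\tau)\}$, where $p'(y_{i+1})=p(y)$ for $y\in D_u[i+1]$ and $p'=0$ at all other states; $\delta'(x_k,\tau)=\emptyset$; and $\Sigma'$ is the set of $\tau\in\Sigma$ with $\delta'(z,\tau)\ne\emptyset$ for some $z\in V'$. The root $u_0$ is identified with $u$. *)

theory Defs
  imports Complex_Main "HOL-Library.FuncSet"
begin

text \<open>
  The sup condition is stated for nonempty families only: the supremum of the empty family
  in \<open>[0,1]\<close> is \<open>0\<close>, and \<open>r \<otimes> 0 = 0\<close> follows from monotonicity and neutrality of \<open>1\<close>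
  (whereas \<open>Sup {}\<close> on type \<^typ>\<open>real\<close> is meaningless).
\<close>

definition left_continuous_tnorm :: "(real \<Rightarrow> real \<Rightarrow> real) \<Rightarrow> bool" where
  "left_continuous_tnorm T \<longleftrightarrow>
     (\<forall>a\<in>{0..1}. \<forall>b\<in>{0..1}. T a b \<in> {0..1}) \<and>
     (\<forall>a\<in>{0..1}. \<forall>b\<in>{0..1}. T a b = T b a) \<and>
     (\<forall>a\<in>{0..1}. \<forall>b\<in>{0..1}. \<forall>c\<in>{0..1}. T (T a b) c = T a (T b c)) \<and>
     (\<forall>a\<in>{0..1}. \<forall>b\<in>{0..1}. \<forall>c\<in>{0..1}. \<forall>d\<in>{0..1}. a \<le> b \<longrightarrow> c \<le> d \<longrightarrow> T a c \<le> T b d) \<and>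
     (\<forall>a\<in>{0..1}. T 1 a = a \<and> T a 1 = a) \<and>
     (\<forall>r\<in>{0..1}. \<forall>A\<subseteq>{0..1}. A \<noteq> {} \<longrightarrow> T r (Sup A) = (SUP a\<in>A. T r a))"

definition residuum :: "(real \<Rightarrow> real \<Rightarrow> real) \<Rightarrow> real \<Rightarrow> real \<Rightarrow> real" where
  "residuum T t r = Sup {s \<in> {0..1}. T s t \<le> r}"

definition fuzzy_sets :: "'a set \<Rightarrow> ('a \<Rightarrow> real) set" where
  "fuzzy_sets V = V \<rightarrow>\<^sub>E {0..1}"

definition sup_degree :: "('a \<Rightarrow> real) \<Rightarrow> 'a set \<Rightarrow> real" where
  "sup_degree p X = (if X = {} then 0 else (SUP x\<in>X. p x))"

record ('a, 'l) nfts =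
  states :: "'a set"
  labels :: "'l set"
  trans_rel :: "('a \<times> 'l \<times> ('a \<Rightarrow> real)) set"

definition is_nfts :: "('a, 'l) nfts \<Rightarrow> bool" where
  "is_nfts S \<longleftrightarrow> finite (states S) \<and> states S \<noteq> {} \<and>
     trans_rel S \<subseteq> states S \<times> labels S \<times> fuzzy_sets (states S)"

definition delta :: "('a, 'l) nfts \<Rightarrow> 'a \<Rightarrow> 'l \<Rightarrow> ('a \<Rightarrow> real) set" where
  "delta S u \<tau> = {p. (u, \<tau>, p) \<in> trans_rel S}"

text \<open>
  State sets are finite and nonempty wherever this is used, so both infima are minima of
  values in \<open>[0,1]\<close>.
\<close>

definition similarity ::
  "(real \<Rightarrow> real \<Rightarrow> real) \<Rightarrow> 'a set \<Rightarrow> 'b set \<Rightarrow> ('a \<Rightarrow> real) \<Rightarrow> ('b \<Rightarrow> real) \<Rightarrow> ('a \<times> 'b) set \<Rightarrow> real"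
where
  "similarity T V1 V2 p q R =
     min (INF x\<in>V1. residuum T (p x) (sup_degree q (R `` {x})))
         (INF y\<in>V2. residuum T (q y) (sup_degree p (R\<inverse> `` {y})))"

definition dagger ::
  "(real \<Rightarrow> real \<Rightarrow> real) \<Rightarrow> 'a set \<Rightarrow> 'b set \<Rightarrow> real \<Rightarrow> ('a \<times> 'b) set
     \<Rightarrow> (('a \<Rightarrow> real) \<times> ('b \<Rightarrow> real)) set"
where
  "dagger T V1 V2 \<alpha> R =
     {(p, q). p \<in> fuzzy_sets V1 \<and> q \<in> fuzzy_sets V2 \<and> similarity T V1 V2 p q R \<ge> \<alpha>}"

primrec limited_bisim ::
  "(real \<Rightarrow> real \<Rightarrow> real) \<Rightarrow> ('a, 'l) nfts \<Rightarrow> real \<Rightarrow> nat \<Rightarrow> ('a \<times> 'a) set"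
where
  "limited_bisim T S \<alpha> 0 = states S \<times> states S"
| "limited_bisim T S \<alpha> (Suc i) =
     {(u, v). u \<in> states S \<and> v \<in> states S \<and>
        (\<forall>\<tau>\<in>labels S.
          (\<forall>p\<in>delta S u \<tau>. \<exists>q\<in>delta S v \<tau>.
             (p, q) \<in> dagger T (states S) (states S) \<alpha> (limited_bisim T S \<alpha> i)) \<and>
          (\<forall>q\<in>delta S v \<tau>. \<exists>p\<in>delta S u \<tau>.
             (p, q) \<in> dagger T (states S) (states S) \<alpha> (limited_bisim T S \<alpha> i)))}"

text \<open>
  The two systems may have different label sets; a label belonging to only one of them has no
  transitions in the other, hence the quantification over the union.
\<close>

definition alpha_bisimulation ::
  "(real \<Rightarrow> real \<Rightarrow> real) \<Rightarrow> real \<Rightarrow> ('a, 'l) nfts \<Rightarrow> ('b, 'l) nfts \<Rightarrow> ('a \<times> 'b) set \<Rightarrow> bool"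
where
  "alpha_bisimulation T \<alpha> S1 S2 R \<longleftrightarrow> R \<subseteq> states S1 \<times> states S2 \<and>
     (\<forall>(x, y)\<in>R. \<forall>\<tau>\<in>labels S1 \<union> labels S2.
        (\<forall>p\<in>delta S1 x \<tau>. \<exists>q\<in>delta S2 y \<tau>. (p, q) \<in> dagger T (states S1) (states S2) \<alpha> R) \<and>
        (\<forall>q\<in>delta S2 y \<tau>. \<exists>p\<in>delta S1 x \<tau>. (p, q) \<in> dagger T (states S1) (states S2) \<alpha> R))"

primrec reach_level :: "('a, 'l) nfts \<Rightarrow> 'a \<Rightarrow> nat \<Rightarrow> 'a set" where
  "reach_level S u 0 = {u}"
| "reach_level S u (Suc i) =
     {y \<in> states S. \<exists>x\<in>reach_level S u i. \<exists>\<tau>\<in>labels S. \<exists>p\<in>delta S x \<tau>. p y > 0}"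

definition sub_states :: "('a, 'l) nfts \<Rightarrow> 'a \<Rightarrow> nat \<Rightarrow> ('a \<times> nat) set" where
  "sub_states S u k = {(x, i). i \<le> k \<and> x \<in> reach_level S u i}"

definition sub_dist ::
  "('a, 'l) nfts \<Rightarrow> 'a \<Rightarrow> nat \<Rightarrow> nat \<Rightarrow> ('a \<Rightarrow> real) \<Rightarrow> 'a \<times> nat \<Rightarrow> real"
where
  "sub_dist S u k i p =
     (\<lambda>(y, j)\<in>sub_states S u k. if j = Suc i \<and> y \<in> reach_level S u (Suc i) then p y else 0)"

definition sub_trans ::
  "('a, 'l) nfts \<Rightarrow> 'a \<Rightarrow> nat \<Rightarrow> (('a \<times> nat) \<times> 'l \<times> ('a \<times> nat \<Rightarrow> real)) set"
where
  "sub_trans S u k =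
     {((x, i), \<tau>, sub_dist S u k i p) | x i \<tau> p.
        i < k \<and> x \<in> reach_level S u i \<and> \<tau> \<in> labels S \<and> p \<in> delta S x \<tau>}"

definition neighbouring_subsystem :: "('a, 'l) nfts \<Rightarrow> 'a \<Rightarrow> nat \<Rightarrow> ('a \<times> nat, 'l) nfts" where
  "neighbouring_subsystem S u k =
     \<lparr>states = sub_states S u k,
      labels = {\<tau> \<in> labels S. \<exists>z\<in>sub_states S u k. \<exists>p. (z, \<tau>, p) \<in> sub_trans S u k},
      trans_rel = sub_trans S u k\<rparr>"

lemma is_nfts_neighbouring_subsystem:
  assumes "is_nfts S" and "u \<in> states S"
  shows "is_nfts (neighbouring_subsystem S u k)"
proof -
  have lev: "reach_level S u i \<subseteq> states S" for i
    using assms(2) by (cases i) auto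
  have "sub_states S u k \<subseteq> states S \<times> {..k}"
    using lev by (auto simp: sub_states_def)
  then have "finite (sub_states S u k)"
    using assms(1) finite_subset by (fastforce simp: is_nfts_def)
  moreover have "(u, 0) \<in> sub_states S u k"
    by (simp add: sub_states_def)
  moreover have "sub_dist S u k i p \<in> fuzzy_sets (sub_states S u k)"
    if "(x, \<tau>, p) \<in> trans_rel S" for x \<tau> p i
  proof -
    have "p \<in> fuzzy_sets (states S)"
      using assms(1) that by (auto simp: is_nfts_def)
    then have "p y \<in> {0..1}" if "y \<in> reach_level S u j" for y j
      using lev that unfolding fuzzy_sets_def by blast
    then show ?thesis
      unfolding fuzzy_sets_def sub_dist_def restrict_PiE_iff
      by (auto simp del: reach_level.simps)
  qed
  moreover have "sub_trans S u k \<subseteq> sub_states S u k \<times>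
      {\<tau> \<in> labels S. \<exists>z\<in>sub_states S u k. \<exists>p. (z, \<tau>, p) \<in> sub_trans S u k} \<times>
      {sub_dist S u k i p | x i \<tau> p. (x, \<tau>, p) \<in> trans_rel S}"
  proof
    fix t assume t: "t \<in> sub_trans S u k"
    then obtain x i \<tau> p where eq: "t = ((x, i), \<tau>, sub_dist S u k i p)"
      and *: "i < k" "x \<in> reach_level S u i" "\<tau> \<in> labels S" "p \<in> delta S x \<tau>"
      by (auto simp: sub_trans_def)
    have "(x, i) \<in> sub_states S u k" "(x, \<tau>, p) \<in> trans_rel S"
      using * by (auto simp: sub_states_def delta_def)
    with t eq * show "t \<in> sub_states S u k \<times>
      {\<tau> \<in> labels S. \<exists>z\<in>sub_states S u k. \<exists>p. (z, \<tau>, p) \<in> sub_trans S u k} \<times>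
      {sub_dist S u k i p | x i \<tau> p. (x, \<tau>, p) \<in> trans_rel S}"
      by blast
  qed
  ultimately show ?thesis
    unfolding is_nfts_def neighbouring_subsystem_def by auto
qed

end

theory Submission imports Defs begin

text \<open>
  Because the state sets are finite, the supremum of \<open>q\<close> over a nonempty \<open>R `` {x}\<close> is attained
  at a single state. Together with the adjunction between \<open>\<otimes>\<close> and its
  residuum, this turns \<open>(p, q) \<in> R\<^sub>\<alpha>\<^sup>\<dagger>\<close> into a matching condition (\<open>dagger_iff\<close>): every \<open>x\<close>
  with \<open>\<alpha> \<otimes> p x > 0\<close> has an \<open>R\<close>-partner \<open>y\<close> with \<open>\<alpha> \<otimes> p x \<le> q y\<close>, and likewise from
  \<open>q\<close> to \<open>p\<close>. Only states of positive degree matter on either side: \<open>\<alpha> \<otimes> p x > 0\<close>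
  forces \<open>p x > 0\<close>, and then \<open>q y > 0\<close>. The unfolding \<open>T\<^sub>S(u, k)\<close> keeps every
  successor of positive degree one level further down, with the same degree.
  So matchings transfer between \<open>S\<close> and its unfoldings in both directions
  (\<open>matches_sub_dist\<close> and \<open>matches_of_sub_dist\<close>).

  If \<open>u \<approx>\<^sub>k v\<close>, the relation that pairs \<open>(x, i)\<close> with \<open>(y, i)\<close> when \<open>x \<approx>\<^bsub>k-i\<^esub> y\<close> is a
  bisimulation between the unfoldings: each transition uses up one unit of the remaining
  depth \<open>k - i\<close> and descends one level, and at level \<open>k\<close> neither side can move. Conversely,
  in any bisimulation \<open>R\<close> between the unfoldings, a pair of states with at least \<open>n\<close> levels
  below each is in \<open>\<approx>\<^sub>n\<close> after forgetting levels, by induction on \<open>n\<close>; the roots have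
  \<open>k\<close> levels below them.
\<close>

section \<open>The adjunction between t-norm and residuum\<close>

lemma left_continuous_tnormD:
  assumes "left_continuous_tnorm T"
  shows "\<forall>a\<in>{0..1}. \<forall>b\<in>{0..1}. T a b = T b a"
    and "\<forall>a\<in>{0..1}. \<forall>b\<in>{0..1}. \<forall>c\<in>{0..1}. \<forall>d\<in>{0..1}. a \<le> b \<longrightarrow> c \<le> d \<longrightarrow> T a c \<le> T b d"
    and "\<forall>a\<in>{0..1}. T 1 a = a \<and> T a 1 = a"
    and "\<forall>r\<in>{0..1}. \<forall>A\<subseteq>{0..1}. A \<noteq> {} \<longrightarrow> T r (Sup A) = (SUP a\<in>A. T r a)"
  by (insert assms, unfold left_continuous_tnorm_def) (elim conjE, assumption)+

lemma tnorm_commute: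
  assumes "left_continuous_tnorm T" "a \<in> {0..1}" "b \<in> {0..1}"
  shows "T a b = T b a"
  using left_continuous_tnormD(1)[OF assms(1)] assms(2,3) by blast

lemma tnorm_mono:
  assumes "left_continuous_tnorm T" "a \<in> {0..1}" "b \<in> {0..1}" "c \<in> {0..1}" "d \<in> {0..1}"
    and "a \<le> b" "c \<le> d"
  shows "T a c \<le> T b d"
  using left_continuous_tnormD(2)[OF assms(1), rule_format, OF assms(2-)] .

lemma tnorm_le_right:
  assumes T: "left_continuous_tnorm T" and a: "a \<in> {0..1}" and b: "b \<in> {0..1}"
  shows "T a b \<le> b"
proof -
  have "T a b \<le> T 1 b" by (rule tnorm_mono[OF T]) (use a b in auto)
  also have "T 1 b = b" using left_continuous_tnormD(3)[OF T] b by blast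
  finally show ?thesis .
qed

text \<open>
  Left continuity lets the t-norm commute with the supremum that defines the residuum, so the
  residuum itself satisfies the inequality over which it is the supremum.
\<close>

lemma le_residuum_iff:
  assumes T: "left_continuous_tnorm T"
    and a: "a \<in> {0..1}" and t: "t \<in> {0..1}" and r: "r \<in> {0..1}"
  shows "a \<le> residuum T t r \<longleftrightarrow> T a t \<le> r"
proof -
  define A where "A = {s \<in> {0..1}. T s t \<le> r}"
  have res: "residuum T t r = Sup A" by (simp add: residuum_def A_def)
  have sub: "A \<subseteq> {0..1}" by (auto simp: A_def)
  have "T 0 t \<le> 0"
    using tnorm_le_right[OF T t, of 0] tnorm_commute[OF T t, of 0] by simp
  then have "0 \<in> A" using r by (auto simp: A_def)
  then have ne: "A \<noteq> {}" by auto
  have bdd: "bdd_above A" using sub by (meson bdd_above.I atLeastAtMost_iff subset_iff)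
  have Sup01: "Sup A \<in> {0..1}"
  proof -
    have "0 \<le> Sup A" using \<open>0 \<in> A\<close> bdd by (rule cSup_upper)
    moreover have "Sup A \<le> 1" by (rule cSup_least[OF ne]) (use sub in auto)
    ultimately show ?thesis by simp
  qed
  show ?thesis
  proof
    assume le: "a \<le> residuum T t r"
    have "T a t \<le> T (Sup A) t"
      by (rule tnorm_mono[OF T]) (use a t Sup01 le res in auto)
    also have "\<dots> = T t (Sup A)" by (rule tnorm_commute[OF T Sup01 t])
    also have "\<dots> = (SUP s\<in>A. T t s)"
      using left_continuous_tnormD(4)[OF T] t sub ne by blast
    also have "\<dots> \<le> r"
    proof (rule cSUP_least[OF ne])
      fix s assume "s \<in> A"
      then show "T t s \<le> r" using tnorm_commute[OF T t, of s] by (auto simp: A_def)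
    qed
    finally show "T a t \<le> r" .
  next
    assume "T a t \<le> r"
    then have "a \<in> A" using a by (simp add: A_def)
    then show "a \<le> residuum T t r" unfolding res using bdd by (rule cSup_upper)
  qed
qed

section \<open>Pointwise matching of distributions\<close>

lemma le_sup_degree_iff:
  assumes fin: "finite X" and nonneg: "\<And>x. x \<in> X \<Longrightarrow> 0 \<le> p x"
  shows "c \<le> sup_degree p X \<longleftrightarrow> c \<le> 0 \<or> (\<exists>x\<in>X. c \<le> p x)"
proof (cases "X = {}")
  case True
  then show ?thesis by (simp add: sup_degree_def)
next
  case False
  then have "sup_degree p X = Max (p ` X)"
    using fin by (simp add: sup_degree_def cSup_eq_Max)
  then have "c \<le> sup_degree p X \<longleftrightarrow> (\<exists>x\<in>X. c \<le> p x)"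
    using fin False by (simp add: Max_ge_iff)
  then show ?thesis using False nonneg by force
qed

lemma sup_degree_in_unit:
  assumes fin: "finite X" and p: "\<And>x. x \<in> X \<Longrightarrow> p x \<in> {0..1}"
  shows "sup_degree p X \<in> {0..1}"
proof (cases "X = {}")
  case True
  then show ?thesis by (simp add: sup_degree_def)
next
  case False
  then have "sup_degree p X = Max (p ` X)"
    using fin by (simp add: sup_degree_def cSup_eq_Max)
  then have "sup_degree p X \<in> p ` X" using fin False by simp
  then show ?thesis using p by fastforce
qed

text \<open>
  One half of the condition \<open>(p, q) \<in> R\<^sub>\<alpha>\<^sup>\<dagger>\<close>. Isolating one half reduces the back direction of every
  argument to its forth direction, applied to \<open>R\<inverse>\<close>.
\<close>

definition matches ::
  "(real \<Rightarrow> real \<Rightarrow> real) \<Rightarrow> real \<Rightarrow> 'a set \<Rightarrow> ('a \<times> 'b) set \<Rightarrow> ('a \<Rightarrow> real) \<Rightarrow> ('b \<Rightarrow> real) \<Rightarrow> bool"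
where
  "matches T \<alpha> V R p q \<longleftrightarrow> (\<forall>x\<in>V. T \<alpha> (p x) > 0 \<longrightarrow> (\<exists>y. (x, y) \<in> R \<and> T \<alpha> (p x) \<le> q y))"

lemma le_INF_residuum_iff_matches:
  assumes T: "left_continuous_tnorm T" and \<alpha>: "\<alpha> \<in> {0..1}"
    and fin1: "finite V1" and ne1: "V1 \<noteq> {}" and fin2: "finite V2" and R: "R \<subseteq> V1 \<times> V2"
    and p: "p \<in> fuzzy_sets V1" and q: "q \<in> fuzzy_sets V2"
  shows "\<alpha> \<le> (INF x\<in>V1. residuum T (p x) (sup_degree q (R `` {x}))) \<longleftrightarrow> matches T \<alpha> V1 R p q"
proof -
  have image: "finite (R `` {x})" "\<And>y. y \<in> R `` {x} \<Longrightarrow> q y \<in> {0..1}" for x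
  proof -
    have "R `` {x} \<subseteq> V2" using R by auto
    then show "finite (R `` {x})" "\<And>y. y \<in> R `` {x} \<Longrightarrow> q y \<in> {0..1}"
      using fin2 q finite_subset unfolding fuzzy_sets_def by blast+
  qed
  have "\<alpha> \<le> (INF x\<in>V1. residuum T (p x) (sup_degree q (R `` {x})))
      \<longleftrightarrow> (\<forall>x\<in>V1. \<alpha> \<le> residuum T (p x) (sup_degree q (R `` {x})))"
    using fin1 ne1 by (simp add: cInf_eq_Min)
  also have "\<dots> \<longleftrightarrow> (\<forall>x\<in>V1. T \<alpha> (p x) \<le> sup_degree q (R `` {x}))"
  proof (rule ball_cong[OF refl])
    fix x assume "x \<in> V1"
    then have "p x \<in> {0..1}" using p unfolding fuzzy_sets_def by blast
    moreover have "sup_degree q (R `` {x}) \<in> {0..1}" using image by (rule sup_degree_in_unit)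
    ultimately show "\<alpha> \<le> residuum T (p x) (sup_degree q (R `` {x}))
        \<longleftrightarrow> T \<alpha> (p x) \<le> sup_degree q (R `` {x})"
      by (rule le_residuum_iff[OF T \<alpha>])
  qed
  also have "\<dots> \<longleftrightarrow> (\<forall>x\<in>V1. T \<alpha> (p x) \<le> 0 \<or> (\<exists>y\<in>R `` {x}. T \<alpha> (p x) \<le> q y))"
  proof (rule ball_cong[OF refl])
    fix x
    have "\<And>y. y \<in> R `` {x} \<Longrightarrow> 0 \<le> q y" using image(2)[of _ x] by auto
    with image(1) show "T \<alpha> (p x) \<le> sup_degree q (R `` {x})
        \<longleftrightarrow> T \<alpha> (p x) \<le> 0 \<or> (\<exists>y\<in>R `` {x}. T \<alpha> (p x) \<le> q y)"
      by (rule le_sup_degree_iff)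
  qed
  also have "\<dots> \<longleftrightarrow> matches T \<alpha> V1 R p q"
    unfolding matches_def by (auto simp: not_le[symmetric])
  finally show ?thesis .
qed

lemma dagger_iff:
  assumes T: "left_continuous_tnorm T" and \<alpha>: "\<alpha> \<in> {0..1}"
    and fin1: "finite V1" and ne1: "V1 \<noteq> {}" and fin2: "finite V2" and ne2: "V2 \<noteq> {}"
    and R: "R \<subseteq> V1 \<times> V2"
  shows "(p, q) \<in> dagger T V1 V2 \<alpha> R \<longleftrightarrow>
    p \<in> fuzzy_sets V1 \<and> q \<in> fuzzy_sets V2 \<and> matches T \<alpha> V1 R p q \<and> matches T \<alpha> V2 (R\<inverse>) q p"
proof -
  have R': "R\<inverse> \<subseteq> V2 \<times> V1" using R by auto
  show ?thesis
    using le_INF_residuum_iff_matches[OF T \<alpha> fin1 ne1 fin2 R, of p q]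
      le_INF_residuum_iff_matches[OF T \<alpha> fin2 ne2 fin1 R', of q p]
    by (auto simp: dagger_def similarity_def)
qed

section \<open>Transitions of the unfolding\<close>

lemma states_neighbouring_subsystem [simp]:
  "states (neighbouring_subsystem S u k) = sub_states S u k"
  by (simp add: neighbouring_subsystem_def)

lemma mem_sub_states_iff [simp]:
  "(x, i) \<in> sub_states S u k \<longleftrightarrow> i \<le> k \<and> x \<in> reach_level S u i"
  by (simp add: sub_states_def)

lemma reach_level_subset_states: "u \<in> states S \<Longrightarrow> reach_level S u i \<subseteq> states S"
  by (cases i) auto

lemma delta_D:
  assumes "is_nfts S" "p \<in> delta S x \<tau>"
  shows "\<tau> \<in> labels S" "p \<in> fuzzy_sets (states S)"
  using assms unfolding is_nfts_def delta_def by blast+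

lemma fuzzy_sets_apply: "p \<in> fuzzy_sets V \<Longrightarrow> x \<in> V \<Longrightarrow> p x \<in> {0..1}"
  unfolding fuzzy_sets_def by blast

lemma delta_neighbouring_subsystem:
  assumes "is_nfts S"
  shows "delta (neighbouring_subsystem S u k) (x, i) \<tau> =
    (if i < k \<and> x \<in> reach_level S u i then sub_dist S u k i ` delta S x \<tau> else {})"
proof -
  have "delta (neighbouring_subsystem S u k) (x, i) \<tau> = {p'. ((x, i), \<tau>, p') \<in> sub_trans S u k}"
    by (simp add: delta_def neighbouring_subsystem_def)
  then show ?thesis using delta_D(1)[OF assms] by (auto simp: sub_trans_def)
qed

lemma sub_dist_Suc:
  assumes "i < k" "y \<in> reach_level S u (Suc i)"
  shows "sub_dist S u k i p (y, Suc i) = p y"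
  using assms by (simp add: sub_dist_def del: reach_level.simps)

lemma sub_dist_pos_D:
  assumes "(y, j) \<in> sub_states S u k" "sub_dist S u k i p (y, j) > 0"
  shows "j = Suc i" "y \<in> reach_level S u (Suc i)" "sub_dist S u k i p (y, j) = p y"
  using assms by (auto simp: sub_dist_def simp del: reach_level.simps split: if_splits)

lemma positive_successor_reach_level:
  assumes "is_nfts S" "x \<in> reach_level S u i" "p \<in> delta S x \<tau>" "y \<in> states S" "p y > 0"
  shows "y \<in> reach_level S u (Suc i)"
  using assms delta_D(1)[OF assms(1,3)] by auto

lemma sub_dist_in_fuzzy_sets:
  assumes "is_nfts S" "u \<in> states S" "x \<in> reach_level S u i" "i < k" "p \<in> delta S x \<tau>"
  shows "sub_dist S u k i p \<in> fuzzy_sets (sub_states S u k)"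
proof -
  have "sub_dist S u k i p \<in> delta (neighbouring_subsystem S u k) (x, i) \<tau>"
    using assms by (simp add: delta_neighbouring_subsystem)
  from delta_D(2)[OF is_nfts_neighbouring_subsystem[OF assms(1,2)] this] show ?thesis by simp
qed

section \<open>Transfer of matchings between a system and its unfoldings\<close>

text \<open>
  The partner \<open>y\<close> of a state has positive degree in \<open>q\<close>, hence survives in the unfolding of \<open>v\<close>.
\<close>

lemma matches_sub_dist:
  assumes T: "left_continuous_tnorm T" and \<alpha>: "\<alpha> \<in> {0..1}" and S: "is_nfts S"
    and u: "u \<in> states S" and p: "p \<in> fuzzy_sets (states S)"
    and y: "y \<in> reach_level S v j" "j < k" and q: "q \<in> delta S y \<tau>"
    and Q: "Q \<subseteq> states S \<times> states S"
    and m: "matches T \<alpha> (states S) Q p q"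
    and QR: "\<And>x' y'. x' \<in> reach_level S u (Suc i) \<Longrightarrow> y' \<in> reach_level S v (Suc j) \<Longrightarrow>
      (x', y') \<in> Q \<Longrightarrow> ((x', Suc i), (y', Suc j)) \<in> R"
  shows "matches T \<alpha> (sub_states S u k) R (sub_dist S u k i p) (sub_dist S v k j q)"
  unfolding matches_def
proof (intro ballI impI)
  fix z assume z: "z \<in> sub_states S u k" and pos: "T \<alpha> (sub_dist S u k i p z) > 0"
  obtain x' l where zeq: "z = (x', l)" by (cases z)
  have x'V: "x' \<in> states S"
    using z reach_level_subset_states[OF u] unfolding zeq by auto
  have "sub_dist S u k i p z \<in> {0..1}"
    using z fuzzy_sets_apply[OF p x'V] unfolding zeq sub_dist_def by simp
  then have "sub_dist S u k i p z > 0"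
    using tnorm_le_right[OF T \<alpha>] pos by fastforce
  note x' = sub_dist_pos_D[OF z[unfolded zeq] this[unfolded zeq]]
  have pz: "sub_dist S u k i p z = p x'" using x'(3) zeq by simp
  with m pos x'V obtain y' where y': "(x', y') \<in> Q" "T \<alpha> (p x') \<le> q y'"
    unfolding matches_def by auto
  have "q y' > 0" using y' pos pz by simp
  then have lev: "y' \<in> reach_level S v (Suc j)"
    using positive_successor_reach_level[OF S y(1) q] y'(1) Q by blast
  have "(z, (y', Suc j)) \<in> R" using QR[OF x'(2) lev y'(1)] x'(1) zeq by simp
  moreover have "T \<alpha> (sub_dist S u k i p z) \<le> sub_dist S v k j q (y', Suc j)"
    using y'(2) pz sub_dist_Suc[OF y(2) lev] by simp
  ultimately show "\<exists>y. (z, y) \<in> R \<and> T \<alpha> (sub_dist S u k i p z) \<le> sub_dist S v k j q y"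
    by blast
qed

text \<open>
  Here the partner found in the unfolding of \<open>v\<close> has positive degree, hence lies exactly one level
  below the source of the transition; so forgetting levels preserves its degree. The levels
  \<open>i\<close> and \<open>j\<close> of the two sources may differ.
\<close>

lemma matches_of_sub_dist:
  assumes T: "left_continuous_tnorm T" and \<alpha>: "\<alpha> \<in> {0..1}" and S: "is_nfts S"
    and x: "x \<in> reach_level S u i" "i < k" and p: "p \<in> delta S x \<tau>"
    and R: "R \<subseteq> sub_states S u k \<times> sub_states S v k"
    and m: "matches T \<alpha> (sub_states S u k) R (sub_dist S u k i p) (sub_dist S v k j q)"
    and RQ: "\<And>x' y'. ((x', Suc i), (y', Suc j)) \<in> R \<Longrightarrow> (x', y') \<in> Q"
  shows "matches T \<alpha> (states S) Q p q"
  unfolding matches_def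
proof (intro ballI impI)
  fix x' assume x'V: "x' \<in> states S" and pos: "T \<alpha> (p x') > 0"
  have "p x' > 0"
    using tnorm_le_right[OF T \<alpha> fuzzy_sets_apply[OF delta_D(2)[OF S p] x'V]] pos by simp
  then have lev: "x' \<in> reach_level S u (Suc i)"
    by (rule positive_successor_reach_level[OF S x(1) p x'V])
  have px: "sub_dist S u k i p (x', Suc i) = p x'"
    using x(2) lev by (rule sub_dist_Suc)
  have "(x', Suc i) \<in> sub_states S u k"
    using x(2) lev by (simp del: reach_level.simps)
  then obtain w where w: "((x', Suc i), w) \<in> R" "T \<alpha> (p x') \<le> sub_dist S v k j q w"
    using m pos px unfolding matches_def by metis
  obtain y' l where weq: "w = (y', l)" by (cases w)
  have "w \<in> sub_states S v k" "sub_dist S v k j q w > 0"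
    using w R pos by auto
  from sub_dist_pos_D[OF this[unfolded weq]] w show "\<exists>y. (x', y) \<in> Q \<and> T \<alpha> (p x') \<le> q y"
    unfolding weq using RQ by metis
qed

section \<open>Limited bisimilarity and bisimulation of unfoldings\<close>

lemma limited_bisim_subset: "limited_bisim T S \<alpha> n \<subseteq> states S \<times> states S"
  by (cases n) auto

lemma alpha_bisimulation_D:
  assumes "alpha_bisimulation T \<alpha> S1 S2 R" "(x, y) \<in> R" "is_nfts S1" "is_nfts S2"
  shows "p \<in> delta S1 x \<tau> \<Longrightarrow> \<exists>q\<in>delta S2 y \<tau>. (p, q) \<in> dagger T (states S1) (states S2) \<alpha> R"
    and "q \<in> delta S2 y \<tau> \<Longrightarrow> \<exists>p\<in>delta S1 x \<tau>. (p, q) \<in> dagger T (states S1) (states S2) \<alpha> R"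
  using assms delta_D(1) unfolding alpha_bisimulation_def by fast+

context
  fixes T :: "real \<Rightarrow> real \<Rightarrow> real" and S :: "('a, 'l) nfts" and \<alpha> :: real
    and u v :: 'a and k :: nat
  assumes T: "left_continuous_tnorm T" and S: "is_nfts S" and \<alpha>: "\<alpha> \<in> {0..1}"
    and u: "u \<in> states S" and v: "v \<in> states S"
begin

lemma dagger_limited_bisim_iff:
  "(p, q) \<in> dagger T (states S) (states S) \<alpha> (limited_bisim T S \<alpha> n) \<longleftrightarrow>
    p \<in> fuzzy_sets (states S) \<and> q \<in> fuzzy_sets (states S) \<and>
    matches T \<alpha> (states S) (limited_bisim T S \<alpha> n) p q \<and>
    matches T \<alpha> (states S) ((limited_bisim T S \<alpha> n)\<inverse>) q p"
  using S unfolding is_nfts_def by (intro dagger_iff[OF T \<alpha>] limited_bisim_subset) auto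

lemma dagger_sub_states_iff:
  assumes "R \<subseteq> sub_states S u k \<times> sub_states S v k"
  shows "(p, q) \<in> dagger T (sub_states S u k) (sub_states S v k) \<alpha> R \<longleftrightarrow>
    p \<in> fuzzy_sets (sub_states S u k) \<and> q \<in> fuzzy_sets (sub_states S v k) \<and>
    matches T \<alpha> (sub_states S u k) R p q \<and> matches T \<alpha> (sub_states S v k) (R\<inverse>) q p"
  using is_nfts_neighbouring_subsystem[OF S u, of k] is_nfts_neighbouring_subsystem[OF S v, of k]
  by (intro dagger_iff[OF T \<alpha> _ _ _ _ assms]) (auto simp: is_nfts_def)

lemma dagger_sub_dist_of_limited_bisim:
  assumes R: "R \<subseteq> sub_states S u k \<times> sub_states S v k" and i: "i < k"
    and x: "x \<in> reach_level S u i" and y: "y \<in> reach_level S v i"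
    and p: "p \<in> delta S x \<tau>" and q: "q \<in> delta S y \<tau>"
    and pq: "(p, q) \<in> dagger T (states S) (states S) \<alpha> (limited_bisim T S \<alpha> n)"
    and R': "\<And>x' y'. x' \<in> reach_level S u (Suc i) \<Longrightarrow> y' \<in> reach_level S v (Suc i) \<Longrightarrow>
      (x', y') \<in> limited_bisim T S \<alpha> n \<Longrightarrow> ((x', Suc i), (y', Suc i)) \<in> R"
  shows "(sub_dist S u k i p, sub_dist S v k i q)
    \<in> dagger T (sub_states S u k) (sub_states S v k) \<alpha> R"
proof -
  let ?Q = "limited_bisim T S \<alpha> n"
  have Q: "?Q \<subseteq> states S \<times> states S" "?Q\<inverse> \<subseteq> states S \<times> states S"
    using limited_bisim_subset[of T S \<alpha> n] by auto
  note pq = pq[unfolded dagger_limited_bisim_iff]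
  have "matches T \<alpha> (sub_states S u k) R (sub_dist S u k i p) (sub_dist S v k i q)"
    using R' pq by (intro matches_sub_dist[OF T \<alpha> S u _ y i q Q(1)]) auto
  moreover have "matches T \<alpha> (sub_states S v k) (R\<inverse>) (sub_dist S v k i q) (sub_dist S u k i p)"
    using R' pq by (intro matches_sub_dist[OF T \<alpha> S v _ x i p Q(2)]) auto
  ultimately show ?thesis
    unfolding dagger_sub_states_iff[OF R]
    using sub_dist_in_fuzzy_sets[OF S u x i p] sub_dist_in_fuzzy_sets[OF S v y i q] by simp
qed

text \<open>
  The remaining depth \<open>k - i\<close> is the index of limited bisimilarity at level \<open>i\<close>. It drops by one
  exactly when a transition descends one level, so the successors fall into the same relation.
\<close>

lemma alpha_bisimulation_of_limited_bisim:
  "alpha_bisimulation T \<alpha> (neighbouring_subsystem S u k) (neighbouring_subsystem S v k)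
    {((x, i), (y, i)) | x y i. i \<le> k \<and> x \<in> reach_level S u i \<and> y \<in> reach_level S v i \<and>
      (x, y) \<in> limited_bisim T S \<alpha> (k - i)}"
  (is "alpha_bisimulation _ _ _ _ ?R")
proof -
  define R where "R = ?R"
  have R: "R \<subseteq> sub_states S u k \<times> sub_states S v k" by (auto simp: R_def)
  have step: "(\<forall>p'\<in>delta (neighbouring_subsystem S u k) (x, i) \<tau>.
        \<exists>q'\<in>delta (neighbouring_subsystem S v k) (y, i) \<tau>.
          (p', q') \<in> dagger T (sub_states S u k) (sub_states S v k) \<alpha> R) \<and>
      (\<forall>q'\<in>delta (neighbouring_subsystem S v k) (y, i) \<tau>.
        \<exists>p'\<in>delta (neighbouring_subsystem S u k) (x, i) \<tau>.
          (p', q') \<in> dagger T (sub_states S u k) (sub_states S v k) \<alpha> R)"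
    if x: "x \<in> reach_level S u i" and y: "y \<in> reach_level S v i"
      and xy: "(x, y) \<in> limited_bisim T S \<alpha> (k - i)" for x y i \<tau>
  proof (cases "i < k")
    case False
    then show ?thesis by (simp add: delta_neighbouring_subsystem[OF S])
  next
    case i: True
    have "k - i = Suc (k - Suc i)" using i by simp
    with xy have xy': "(x, y) \<in> limited_bisim T S \<alpha> (Suc (k - Suc i))" by simp
    have lift: "(sub_dist S u k i p, sub_dist S v k i q)
        \<in> dagger T (sub_states S u k) (sub_states S v k) \<alpha> R"
      if "p \<in> delta S x \<tau>" "q \<in> delta S y \<tau>"
        "(p, q) \<in> dagger T (states S) (states S) \<alpha> (limited_bisim T S \<alpha> (k - Suc i))" for p q
      by (rule dagger_sub_dist_of_limited_bisim[OF R i x y that])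
        (use i in \<open>simp add: R_def del: reach_level.simps\<close>)
    have delta_eq: "delta (neighbouring_subsystem S u k) (x, i) \<tau> = sub_dist S u k i ` delta S x \<tau>"
      "delta (neighbouring_subsystem S v k) (y, i) \<tau> = sub_dist S v k i ` delta S y \<tau>"
      using x y i by (simp_all add: delta_neighbouring_subsystem[OF S])
    have moves: "(\<forall>p\<in>delta S x \<tau>. \<exists>q\<in>delta S y \<tau>.
          (p, q) \<in> dagger T (states S) (states S) \<alpha> (limited_bisim T S \<alpha> (k - Suc i))) \<and>
        (\<forall>q\<in>delta S y \<tau>. \<exists>p\<in>delta S x \<tau>.
          (p, q) \<in> dagger T (states S) (states S) \<alpha> (limited_bisim T S \<alpha> (k - Suc i)))"
    proof (cases "\<tau> \<in> labels S")
      case True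
      then show ?thesis using xy' by simp
    next
      case False
      then have "delta S x \<tau> = {}" "delta S y \<tau> = {}" using delta_D(1)[OF S] by blast+
      then show ?thesis by simp
    qed
    show ?thesis
      unfolding delta_eq ball_simps bex_simps
    proof (intro conjI ballI)
      fix p assume p: "p \<in> delta S x \<tau>"
      then obtain q where "q \<in> delta S y \<tau>"
        "(p, q) \<in> dagger T (states S) (states S) \<alpha> (limited_bisim T S \<alpha> (k - Suc i))"
        using moves by blast
      with lift[OF p this]
      show "\<exists>q\<in>delta S y \<tau>. (sub_dist S u k i p, sub_dist S v k i q)
          \<in> dagger T (sub_states S u k) (sub_states S v k) \<alpha> R" by blast
    next
      fix q assume q: "q \<in> delta S y \<tau>"
      then obtain p where p: "p \<in> delta S x \<tau>"
        and pq: "(p, q) \<in> dagger T (states S) (states S) \<alpha> (limited_bisim T S \<alpha> (k - Suc i))"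
        using moves by blast
      from lift[OF p q pq] p
      show "\<exists>p\<in>delta S x \<tau>. (sub_dist S u k i p, sub_dist S v k i q)
          \<in> dagger T (sub_states S u k) (sub_states S v k) \<alpha> R" by blast
    qed
  qed
  show ?thesis
    unfolding R_def[symmetric] alpha_bisimulation_def states_neighbouring_subsystem
  proof (intro conjI ballI, rule R)
    fix z assume "z \<in> R"
    then obtain x y i where z: "z = ((x, i), (y, i))"
      and xy: "x \<in> reach_level S u i"
        "y \<in> reach_level S v i" "(x, y) \<in> limited_bisim T S \<alpha> (k - i)"
      unfolding R_def by blast
    show "case z of (x, y) \<Rightarrow>
        \<forall>\<tau>\<in>labels (neighbouring_subsystem S u k) \<union> labels (neighbouring_subsystem S v k).
        (\<forall>p'\<in>delta (neighbouring_subsystem S u k) x \<tau>.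
          \<exists>q'\<in>delta (neighbouring_subsystem S v k) y \<tau>.
            (p', q') \<in> dagger T (sub_states S u k) (sub_states S v k) \<alpha> R) \<and>
        (\<forall>q'\<in>delta (neighbouring_subsystem S v k) y \<tau>.
          \<exists>p'\<in>delta (neighbouring_subsystem S u k) x \<tau>.
            (p', q') \<in> dagger T (sub_states S u k) (sub_states S v k) \<alpha> R)"
      unfolding z prod.case by (rule ballI, rule step[OF xy])
  qed
qed

text \<open>
  A bisimulation between the unfoldings may relate states at different levels, so the induction
  carries two level bounds.
\<close>

lemma limited_bisim_of_alpha_bisimulation:
  assumes bis: "alpha_bisimulation T \<alpha> (neighbouring_subsystem S u k) (neighbouring_subsystem S v k) R"
    and "((x, i), (y, j)) \<in> R" and "i + n \<le> k" and "j + n \<le> k"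
  shows "(x, y) \<in> limited_bisim T S \<alpha> n"
  using assms(2-)
proof (induction n arbitrary: x y i j)
  have R: "R \<subseteq> sub_states S u k \<times> sub_states S v k" "R\<inverse> \<subseteq> sub_states S v k \<times> sub_states S u k"
    using bis by (auto simp: alpha_bisimulation_def)
  have in_states: "x \<in> states S" "y \<in> states S" "x \<in> reach_level S u i" "y \<in> reach_level S v j"
    if "((x, i), (y, j)) \<in> R" for x i y j
    using that R(1) reach_level_subset_states[OF u] reach_level_subset_states[OF v] by fastforce+
  {
    case 0
    then show ?case using in_states by simp
  next
    case (Suc n)
    note xy = in_states[OF Suc.prems(1)]
    have i: "i < k" and j: "j < k" using Suc.prems by auto
    have delta_eq:
      "delta (neighbouring_subsystem S u k) (x, i) \<tau> = sub_dist S u k i ` delta S x \<tau>"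
      "delta (neighbouring_subsystem S v k) (y, j) \<tau> = sub_dist S v k j ` delta S y \<tau>" for \<tau>
      using xy i j by (simp_all add: delta_neighbouring_subsystem[OF S])
    have RQ: "(x', y') \<in> limited_bisim T S \<alpha> n" if "((x', Suc i), (y', Suc j)) \<in> R" for x' y'
      using Suc.IH[OF that] Suc.prems by simp
    have descend: "(p, q) \<in> dagger T (states S) (states S) \<alpha> (limited_bisim T S \<alpha> n)"
      if p: "p \<in> delta S x \<tau>" and q: "q \<in> delta S y \<tau>"
        and pq: "(sub_dist S u k i p, sub_dist S v k j q)
          \<in> dagger T (sub_states S u k) (sub_states S v k) \<alpha> R" for p q \<tau>
    proof -
      note pq = pq[unfolded dagger_sub_states_iff[OF R(1)]]
      have "matches T \<alpha> (states S) (limited_bisim T S \<alpha> n) p q"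
        by (rule matches_of_sub_dist[OF T \<alpha> S xy(3) i p R(1)]) (use pq RQ in auto)
      moreover have "matches T \<alpha> (states S) ((limited_bisim T S \<alpha> n)\<inverse>) q p"
        by (rule matches_of_sub_dist[OF T \<alpha> S xy(4) j q R(2)]) (use pq RQ in auto)
      ultimately show ?thesis
        using delta_D(2)[OF S p] delta_D(2)[OF S q] by (simp add: dagger_limited_bisim_iff)
    qed
    note step = alpha_bisimulation_D[OF bis Suc.prems(1)
        is_nfts_neighbouring_subsystem[OF S u] is_nfts_neighbouring_subsystem[OF S v],
        unfolded states_neighbouring_subsystem delta_eq]
    show ?case
      unfolding limited_bisim.simps
    proof (intro CollectI case_prodI conjI ballI)
      fix \<tau> p assume p: "p \<in> delta S x \<tau>"
      from step(1)[OF imageI[OF p]] descend[OF p]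
      show "\<exists>q\<in>delta S y \<tau>. (p, q) \<in> dagger T (states S) (states S) \<alpha> (limited_bisim T S \<alpha> n)"
        by blast
    next
      fix \<tau> q assume q: "q \<in> delta S y \<tau>"
      from step(2)[OF imageI[OF q]] descend[OF _ q]
      show "\<exists>p\<in>delta S x \<tau>. (p, q) \<in> dagger T (states S) (states S) \<alpha> (limited_bisim T S \<alpha> n)"
        by blast
    qed (use xy in auto)
  }
qed

end

theorem theorem6p1:
  fixes T :: "real \<Rightarrow> real \<Rightarrow> real"
    and S :: "('a, 'l) nfts"
    and k :: nat and \<alpha> :: real and u v :: 'a
  assumes "left_continuous_tnorm T"
    and "is_nfts S"
    and "\<alpha> \<in> {0..1}"
    and "u \<in> states S" and "v \<in> states S"
  shows "(u, v) \<in> limited_bisim T S \<alpha> k \<longleftrightarrow>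
    (\<exists>R. alpha_bisimulation T \<alpha> (neighbouring_subsystem S u k) (neighbouring_subsystem S v k) R \<and>
         ((u, 0), (v, 0)) \<in> R)"
proof
  assume "(u, v) \<in> limited_bisim T S \<alpha> k"
  with alpha_bisimulation_of_limited_bisim[OF assms, of k]
  show "\<exists>R. alpha_bisimulation T \<alpha> (neighbouring_subsystem S u k) (neighbouring_subsystem S v k) R \<and>
      ((u, 0), (v, 0)) \<in> R"
    by (intro exI conjI) auto
next
  assume "\<exists>R. alpha_bisimulation T \<alpha> (neighbouring_subsystem S u k) (neighbouring_subsystem S v k) R \<and>
      ((u, 0), (v, 0)) \<in> R"
  then obtain R
    where "alpha_bisimulation T \<alpha> (neighbouring_subsystem S u k) (neighbouring_subsystem S v k) R"
      and "((u, 0), (v, 0)) \<in> R"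
    by blast
  from limited_bisim_of_alpha_bisimulation[OF assms this, of k]
  show "(u, v) \<in> limited_bisim T S \<alpha> k" by simp
qed

end
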